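(* Let $p\in(0,1)$ be a constant (independent of $n$). Then for every $d\in\mathbb{N}$ and every $\varepsilon>0$ there exists $n_0$ such that for all $n\ge n_0$, $$u_d(n,p)\le(2+\varepsilon)\left[\frac d2\right]\log_{\frac{1}{1-p}}(np)\quad\text{and}\quad u_d'(n,p)\le(2+\varepsilon)\left[\frac d2\right]\log_{\frac{1}{1-p}}(np).$$
   Context: $G(n,p)$ is the Erdős–Rényi random graph on $n$ labelled vertices (vertex set $V$), each edge present independently with probability $p$; $\mathbb{P}_{n,p}$ is the corresponding probability; $[x]$ is the integer part. A diameter graph in $\mathbb{R}^d$ is a graph $(V,E)$ with $V\subset\mathbb{R}^d$ finite and $E=\{\{\mathbf{x},\mathbf{y}\}\subseteq V: |\mathbf{x}-\mathbf{y}|=\operatorname{diam}V\}$, where $\operatorname{diam}V=\max_{\mathbf{x},\mathbf{y}\in V}|\mathbf{x}-\mathbf{y}|$ (Euclidean norm); a graph is a diameter graph in $\mathbb{R}^d$ if it is isomorphic to one. $u_d(n,p)$ is the largest positive integer $k$ such that $\mathbb{P}_{n,p}\big(\exists W\subseteq V,\ |W|=k,\ G[W]$ is a diameter graph in $\mathbb{R}^d$ and $\chi(G[W])=d+1\big)>\frac12$, where $G[W]$ is the induced subgraph; if no such $k$ exists, $u_d(n,p)=0$. $u_d'(n,p)$ is defined identically with the additional requirement that $G[W]$ be connected.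
   Formalization: The formal theorem assumes d ≥ 2; for d = 1 (and d = 0) the right-hand side is 0 since [d/2] = 0, while a single edge (a single vertex) gives u_1, u_1' ≥ 2 (u_0 ≥ 1) for large n, so the claim fails there. *)

theory Defs
  imports "HOL-Analysis.Analysis"
begin

text \<open>Simple graphs on vertex set {0..<n}: an edge set is a set of 2-element subsets.\<close>

definition all_pairs :: "nat \<Rightarrow> nat set set" where
  "all_pairs n = {e. e \<subseteq> {0..<n} \<and> card e = 2}"

definition Pnp :: "nat \<Rightarrow> real \<Rightarrow> (nat set set \<Rightarrow> bool) \<Rightarrow> real" where
  "Pnp n p Q = (\<Sum>E\<in>{E. E \<subseteq> all_pairs n \<and> Q E}.
      p ^ card E * (1 - p) ^ (card (all_pairs n) - card E))"

definition induced :: "nat set set \<Rightarrow> nat set \<Rightarrow> nat set set" where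
  "induced E W = {e \<in> E. e \<subseteq> W}"

definition colourable :: "nat set \<Rightarrow> nat set set \<Rightarrow> nat \<Rightarrow> bool" where
  "colourable W E k \<longleftrightarrow> (\<exists>c. (\<forall>x\<in>W. c x < k) \<and>
      (\<forall>x\<in>W. \<forall>y\<in>W. {x, y} \<in> E \<longrightarrow> x \<noteq> y \<longrightarrow> c x \<noteq> c y))"

definition chromatic :: "nat set \<Rightarrow> nat set set \<Rightarrow> nat" where
  "chromatic W E = (LEAST k. colourable W E k)"

definition diameter_graph :: "'d::finite itself \<Rightarrow> nat set \<Rightarrow> nat set set \<Rightarrow> bool" where
  "diameter_graph _ W E \<longleftrightarrow> finite W \<and> (\<exists>f :: nat \<Rightarrow> real^'d. inj_on f W \<and>
      (\<forall>x\<in>W. \<forall>y\<in>W. x \<noteq> y \<longrightarrow>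
         ({x, y} \<in> E \<longleftrightarrow> dist (f x) (f y) = diameter (f ` W))))"

definition graph_connected :: "nat set \<Rightarrow> nat set set \<Rightarrow> bool" where
  "graph_connected W E \<longleftrightarrow> W \<noteq> {} \<and>
     (\<forall>x\<in>W. \<forall>y\<in>W. (\<lambda>a b. a \<in> W \<and> b \<in> W \<and> {a, b} \<in> E)\<^sup>*\<^sup>* x y)"

definition good_event :: "'d::finite itself \<Rightarrow> bool \<Rightarrow> nat \<Rightarrow> nat \<Rightarrow> nat set set \<Rightarrow> bool" where
  "good_event t conn n k E \<longleftrightarrow> (\<exists>W. W \<subseteq> {0..<n} \<and> card W = k \<and>
      diameter_graph t W (induced E W) \<and>
      chromatic W (induced E W) = CARD('d) + 1 \<and>
      (conn \<longrightarrow> graph_connected W (induced E W)))"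

definition u_gen :: "'d::finite itself \<Rightarrow> bool \<Rightarrow> nat \<Rightarrow> real \<Rightarrow> nat" where
  "u_gen t conn n p =
     (let S = {k. 0 < k \<and> Pnp n p (good_event t conn n k) > 1/2}
      in if S = {} then 0 else Max S)"

definition u_d :: "'d::finite itself \<Rightarrow> nat \<Rightarrow> real \<Rightarrow> nat" where
  "u_d t n p = u_gen t False n p"

definition u_d' :: "'d::finite itself \<Rightarrow> nat \<Rightarrow> real \<Rightarrow> nat" where
  "u_d' t n p = u_gen t True n p"

end

theory Submission
  imports Defs "HOL-Library.Function_Algebras" "HOL-Real_Asymp.Real_Asymp"
begin

text \<open>
  Already the existence of an induced diameter graph on \<open>k\<close> vertices is unlikely.
  Put \<open>m = d div 2\<close>.

  A diameter graph in dimension \<open>d\<close> contains no complete \<open>(m + 1)\<close>-partite graph with parts of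
  size 3, since distinct parts span orthogonal directions and each part, lying on
  a sphere, spans a plane. By
  Erdos--Stone it has at least \<open>(1/m - o(1)) k\<^sup>2 / 2\<close> non-edges, so a fixed one occurs on
  a fixed vertex set with probability at most \<open>(1 - p)\<close> to that power. On the other hand,
  the adjacencies are the zero pattern of at most \<open>k\<^sup>2\<close> quadratic polynomials in \<open>d k + 1\<close>
  variables (the coordinates and the diameter), so by the linear algebra argument of
  Ronyai, Babai and Ganapathy there are only \<open>exp (O (k log k))\<close> labelled diameter graphs. A
  union bound over the at most \<open>n\<^sup>k\<close> vertex sets and these graphs gives the claim.
\<close>

subsection \<open>Zero patterns of polynomials\<close>

interpretation fun_space: vector_space "\<lambda>(c::real) (f::'a \<Rightarrow> real) x. c * f x"
  by unfold_locales (auto simp: fun_eq_iff algebra_simps)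

lemma sum_fun_apply: "(\<Sum>j\<in>J. f j) x = (\<Sum>j\<in>J. (f j x :: real))"
  by (induction J rule: infinite_finite_induct) auto

text \<open>The linear algebra argument of Ronyai, Babai and Ganapathy. Each support
  \<open>T\<close> that occurs yields the product of the \<open>F j\<close> over \<open>T\<close>;
  these products are linearly independent, yet all lie in a space spanned by \<open>card B\<close>
  functions. A support is the complement in \<open>J\<close> of a zero pattern, so both have the
  same count.\<close>

lemma card_zero_patterns_le:
  fixes F :: "'j \<Rightarrow> 'a \<Rightarrow> real"
  assumes J: "finite J" and B: "finite B"
    and span: "\<And>T. T \<subseteq> J \<Longrightarrow> (\<lambda>x. \<Prod>j\<in>T. F j x) \<in> fun_space.span B"
  shows "card (range (\<lambda>x. {j\<in>J. F j x \<noteq> 0})) \<le> card B"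
proof -
  define supp where "supp x = {j\<in>J. F j x \<noteq> 0}" for x
  define g where "g T = (\<lambda>x. \<Prod>j\<in>T. F j x)" for T
  have sub: "T \<subseteq> J" "finite T" if "T \<in> range supp" for T
    using that J by (auto simp: supp_def intro: finite_subset)
  have fin: "finite (range supp)"
    by (rule finite_subset[of _ "Pow J"]) (use J in \<open>auto simp: supp_def\<close>)
  have nz: "g T x \<noteq> 0 \<longleftrightarrow> T \<subseteq> supp x" if "T \<in> range supp" for T x
    using sub[OF that] by (auto simp: g_def supp_def)
  have inj: "inj_on g (range supp)"
  proof (rule inj_onI)
    fix T T' assume T: "T \<in> range supp" and T': "T' \<in> range supp" and eq: "g T = g T'"
    have "T \<subseteq> supp x \<longleftrightarrow> T' \<subseteq> supp x" for x
      using nz[OF T, of x] nz[OF T', of x] eq by simp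
    with T T' show "T = T'" by (metis equalityI image_iff subset_refl)
  qed
  \<comment> \<open>\<open>g T\<close> is nonzero at a point with support \<open>T'\<close> iff \<open>T \<subseteq> T'\<close>: a triangular system.\<close>
  have "fun_space.independent (g ` range supp)"
  proof (rule fun_space.independent_if_scalars_zero)
    show "finite (g ` range supp)" using fin by simp
    fix c h
    assume "(\<Sum>h\<in>g ` range supp. (\<lambda>x. c h * h x)) = 0" and h: "h \<in> g ` range supp"
    then have "(\<Sum>T\<in>range supp. (\<lambda>x. c (g T) * g T x)) = 0"
      by (simp add: sum.reindex[OF inj])
    then have zero: "(\<Sum>T\<in>range supp. c (g T) * g T x) = 0" for x
      using sum_fun_apply[of "\<lambda>T x. c (g T) * g T x" "range supp" x] by simp
    have "c (g T) = 0" if "T \<in> range supp" for T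
      using that
    proof (induction "card T" arbitrary: T rule: less_induct)
      case less
      \<comment> \<open>Evaluate the relation at a point with support exactly \<open>T\<close>.
        Proper subsets of \<open>T\<close> have coefficient zero by induction, and products over
        sets not contained in \<open>T\<close> vanish there.\<close>
      then obtain x where x: "T = supp x" by auto
      have "c (g T') * g T' x = 0" if "T' \<in> range supp - {T}" for T'
      proof (cases "T' \<subseteq> T")
        case True
        with that sub(2)[OF less.prems] have "card T' < card T"
          by (intro psubset_card_mono) auto
        with less.hyps that show ?thesis by auto
      next
        case False
        with that x nz[of T' x] show ?thesis by auto
      qed
      then have "(\<Sum>T'\<in>range supp - {T}. c (g T') * g T' x) = 0"
        by (intro sum.neutral) blast
      then have "c (g T) * g T x = 0"
        using zero[of x] fin less.prems by (simp add: sum.remove[of _ T])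
      with nz[OF less.prems] x show ?case by auto
    qed
    with h show "c h = 0" by auto
  qed
  moreover have "g ` range supp \<subseteq> fun_space.span B"
    unfolding g_def using span sub(1) by blast
  ultimately have "card (g ` range supp) \<le> card B"
    using fun_space.independent_span_bound[OF B] by blast
  then show ?thesis
    using card_image[OF inj] by (simp add: supp_def)
qed

text \<open>The degree bound \<open>N\<close> is on each variable separately.\<close>

definition poly_space :: "('i \<Rightarrow> 'a \<Rightarrow> real) \<Rightarrow> 'i set \<Rightarrow> nat \<Rightarrow> ('a \<Rightarrow> real) set" where
  "poly_space v I N =
     fun_space.span ((\<lambda>a x. \<Prod>i\<in>I. v i x ^ a i) ` (I \<rightarrow>\<^sub>E {..N}))"

section \<open>Closure properties of the polynomial space\<close>

lemma monomial_in_poly_space: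
  assumes "\<And>i. i \<in> I \<Longrightarrow> a i \<le> N"
  shows "(\<lambda>x. \<Prod>i\<in>I. v i x ^ a i) \<in> poly_space v I N"
proof -
  \<comment> \<open>The spanning monomials are indexed by extensional functions, so that a finite
    \<open>I\<close> gives finitely many; hence the restriction to \<open>I\<close>.\<close>
  have "(\<lambda>x. \<Prod>i\<in>I. v i x ^ a i) = (\<lambda>x. \<Prod>i\<in>I. v i x ^ restrict a I i)"
    by auto
  moreover have "restrict a I \<in> I \<rightarrow>\<^sub>E {..N}" using assms by auto
  ultimately show ?thesis
    unfolding poly_space_def by (intro fun_space.span_base) blast
qed

lemma poly_space_mono:
  assumes "M \<le> N"
  shows "poly_space v I M \<subseteq> poly_space v I N"
  unfolding poly_space_def
  by (intro fun_space.span_mono image_mono PiE_mono) (use assms in auto)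

lemma poly_space_one: "(\<lambda>x. 1) \<in> poly_space v I N"
  using monomial_in_poly_space[of I "\<lambda>_. 0" N v] by simp

lemma poly_space_variable:
  assumes "finite I" "i \<in> I"
  shows "v i \<in> poly_space v I 1"
proof -
  have "(\<lambda>x. \<Prod>k\<in>I. v k x ^ (if k = i then 1 else 0)) = v i"
    using assms by (auto simp: fun_eq_iff if_distrib[of "power _"] prod.delta cong: if_cong)
  with monomial_in_poly_space[of I "\<lambda>k. if k = i then 1 else 0" 1 v] show ?thesis by simp
qed

lemma poly_space_diff:
  "f \<in> poly_space v I N \<Longrightarrow> g \<in> poly_space v I N \<Longrightarrow> (\<lambda>x. f x - g x) \<in> poly_space v I N"
  unfolding poly_space_def using fun_space.span_diff[of f _ g] by (simp add: fun_diff_def)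

lemma poly_space_sum:
  assumes "\<And>j. j \<in> J \<Longrightarrow> f j \<in> poly_space v I N"
  shows "(\<lambda>x. \<Sum>j\<in>J. f j x) \<in> poly_space v I N"
proof -
  have "(\<lambda>x. \<Sum>j\<in>J. f j x) = (\<Sum>j\<in>J. f j)"
    by (simp add: fun_eq_iff sum_fun_apply)
  then show ?thesis
    using assms unfolding poly_space_def by (simp add: fun_space.span_sum)
qed

text \<open>By bilinearity it suffices to multiply two monomials, whose exponents add. The two span
  inductions treat one factor each.\<close>

lemma poly_space_mult:
  assumes "f \<in> poly_space v I M" "g \<in> poly_space v I N"
  shows "(\<lambda>x. f x * g x) \<in> poly_space v I (M + N)"
proof -
  have mono: "(\<lambda>x. (\<Prod>i\<in>I. v i x ^ a i) * g x) \<in> poly_space v I (M + N)"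
    if a: "a \<in> I \<rightarrow>\<^sub>E {..M}" for a
    using assms(2) unfolding poly_space_def[of v I N]
  proof (induction rule: fun_space.span_induct_alt)
    case base
    show ?case using fun_space.span_zero by (simp add: poly_space_def zero_fun_def)
  next
    case (step c h h')
    then obtain b where b: "b \<in> I \<rightarrow>\<^sub>E {..N}" and h: "h = (\<lambda>x. \<Prod>i\<in>I. v i x ^ b i)" by auto
    have "(\<lambda>x. (\<Prod>i\<in>I. v i x ^ a i) * h x) = (\<lambda>x. \<Prod>i\<in>I. v i x ^ (a i + b i))"
      by (simp add: h power_add prod.distrib)
    also have "\<dots> \<in> poly_space v I (M + N)"
      using a b by (intro monomial_in_poly_space add_mono) (auto simp: PiE_iff)
    finally have "(\<lambda>x. (\<Prod>i\<in>I. v i x ^ a i) * h x) \<in> poly_space v I (M + N)" .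
    from fun_space.span_add[OF fun_space.span_scale[OF this[unfolded poly_space_def], of c]
        step.IH[unfolded poly_space_def]]
    show ?case by (simp add: poly_space_def plus_fun_def algebra_simps)
  qed
  show ?thesis
    using assms(1) unfolding poly_space_def[of v I M]
  proof (induction rule: fun_space.span_induct_alt)
    case base
    show ?case using fun_space.span_zero by (simp add: poly_space_def zero_fun_def)
  next
    case (step c h h')
    then have "(\<lambda>x. h x * g x) \<in> poly_space v I (M + N)" using mono by auto
    from fun_space.span_add[OF fun_space.span_scale[OF this[unfolded poly_space_def], of c]
        step.IH[unfolded poly_space_def]]
    show ?case by (simp add: poly_space_def plus_fun_def algebra_simps)
  qed
qed

lemma poly_space_prod:
  assumes "finite T" "\<And>j. j \<in> T \<Longrightarrow> F j \<in> poly_space v I N"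
  shows "(\<lambda>x. \<Prod>j\<in>T. F j x) \<in> poly_space v I (N * card T)"
  using assms
proof (induction rule: finite_induct)
  case empty
  show ?case by (simp add: poly_space_one)
next
  case (insert j T)
  then show ?case using poly_space_mult[of "F j" v I N] by simp
qed

text \<open>A product of distinct \<open>F j\<close> has degree at most \<open>N * card J\<close> in
  each variable, and the bound counts the monomials of that kind.\<close>

lemma card_poly_zero_patterns_le:
  fixes F :: "'j \<Rightarrow> 'a \<Rightarrow> real"
  assumes "finite J" "finite I" and F: "\<And>j. j \<in> J \<Longrightarrow> F j \<in> poly_space v I N"
  shows "card (range (\<lambda>x. {j\<in>J. F j x \<noteq> 0})) \<le> (N * card J + 1) ^ card I"
proof -
  let ?E = "I \<rightarrow>\<^sub>E {..N * card J}"
  let ?B = "(\<lambda>a x. \<Prod>i\<in>I. v i x ^ a i) ` ?E"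
  have E: "finite ?E" using assms by (intro finite_PiE) auto
  have "(\<lambda>x. \<Prod>j\<in>T. F j x) \<in> fun_space.span ?B" if "T \<subseteq> J" for T
    using poly_space_prod[of T F v I N] poly_space_mono[of "N * card T" "N * card J" v I]
      that F card_mono[OF assms(1) that] finite_subset[OF that assms(1)]
    by (auto simp: poly_space_def)
  with assms(1) E have "card (range (\<lambda>x. {j\<in>J. F j x \<noteq> 0})) \<le> card ?B"
    by (intro card_zero_patterns_le) auto
  also have "\<dots> \<le> card ?E" by (rule card_image_le[OF E])
  also have "\<dots> = (N * card J + 1) ^ card I" using assms by (simp add: card_PiE)
  finally show ?thesis .
qed

subsection \<open>Erdos--Stone\<close>

text \<open>Nothing is asked inside a part. Disjointness of the parts is not demanded either; it
  follows when \<open>R\<close> is irreflexive.\<close>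

definition has_multipartite :: "('a \<Rightarrow> 'a \<Rightarrow> bool) \<Rightarrow> 'a set \<Rightarrow> nat \<Rightarrow> nat \<Rightarrow> bool" where
  "has_multipartite R V r t \<longleftrightarrow> (\<exists>P.
     (\<forall>i<r. P i \<subseteq> V \<and> card (P i) = t) \<and>
     (\<forall>i<r. \<forall>j<r. i \<noteq> j \<longrightarrow> (\<forall>x\<in>P i. \<forall>y\<in>P j. R x y)))"

lemma has_multipartite_mono:
  "has_multipartite R V r t \<Longrightarrow> V \<subseteq> V' \<Longrightarrow> has_multipartite R V' r t"
  unfolding has_multipartite_def by (erule exE, rule_tac x = P in exI) blast

text \<open>Pigeonhole: every vertex of \<open>X\<close> selects \<open>t\<close> of its neighbours
  in each old part. There are so few possible selections that \<open>t\<close> vertices of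
  \<open>X\<close> make the same one; they form the new part, and the common selection shrinks the
  old parts.\<close>

lemma has_multipartite_Suc:
  fixes R :: "'a \<Rightarrow> 'a \<Rightarrow> bool"
  assumes V: "finite V" and R: "symp R"
    and P: "\<And>i. i < r \<Longrightarrow> P i \<subseteq> V \<and> card (P i) = T"
    and PR: "\<And>i j x y. \<lbrakk>i < r; j < r; i \<noteq> j; x \<in> P i; y \<in> P j\<rbrakk> \<Longrightarrow> R x y"
    and X: "X \<subseteq> V" "\<And>x i. \<lbrakk>x \<in> X; i < r\<rbrakk> \<Longrightarrow> t \<le> card {w \<in> P i. R x w}"
    and large: "t * (2 ^ T) ^ r \<le> card X"
  shows "has_multipartite R V (Suc r) t"
proof -
  have finX: "finite X" using X V finite_subset by blast
  have finP: "finite (P i)" if "i < r" for i using P[OF that] V finite_subset by blast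
  have "\<exists>S. S \<subseteq> P i \<and> card S = t \<and> (\<forall>w\<in>S. R x w)" if xi: "x \<in> X" "i < r" for x i
  proof -
    obtain S where "S \<subseteq> {w \<in> P i. R x w}" "card S = t"
      using obtain_subset_with_card_n[OF X(2)[OF xi]] by blast
    then show ?thesis by (intro exI[of _ S]) auto
  qed
  then obtain S where S: "\<And>x i. \<lbrakk>x \<in> X; i < r\<rbrakk> \<Longrightarrow>
      S x i \<subseteq> P i \<and> card (S x i) = t \<and> (\<forall>w\<in>S x i. R x w)"
    by metis
  let ?B = "PiE {..<r} (\<lambda>i. Pow (P i))"
  let ?f = "\<lambda>x. restrict (S x) {..<r}"
  have finB: "finite ?B" using finP by (intro finite_PiE) auto
  have "card ?B = (\<Prod>i<r. card (Pow (P i)))" by (simp add: card_PiE)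
  also have "\<dots> = (\<Prod>i<r. 2 ^ T)" by (intro prod.cong) (use P finP in \<open>auto simp: card_Pow\<close>)
  finally have cardB: "card ?B = (2 ^ T) ^ r" by simp
  then have "?B \<noteq> {}" by auto
  moreover have "?f \<in> X \<rightarrow> ?B" using S by auto
  ultimately obtain s where s: "card X \<le> card (?f -` {s} \<inter> X) * card ?B"
    using pigeonhole_card[of ?f X ?B] finX finB by auto
  with large have "t * card ?B \<le> card (?f -` {s} \<inter> X) * card ?B"
    unfolding cardB by (rule order_trans)
  then have "t \<le> card (?f -` {s} \<inter> X)" unfolding cardB by simp
  then obtain Q where Q: "Q \<subseteq> ?f -` {s} \<inter> X" "card Q = t"
    by (meson obtain_subset_with_card_n)
  show ?thesis
  \<comment> \<open>For \<open>t = 0\<close> the set \<open>Q\<close> is empty and offers no vertex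
    from which to read off the properties of \<open>s\<close>; empty parts do instead.\<close>
  proof (cases "t = 0")
    case True
    then show ?thesis unfolding has_multipartite_def by (intro exI[of _ "\<lambda>_. {}"]) auto
  next
    case False
    then obtain q where q: "q \<in> Q" using Q(2) by fastforce
    have s_eq: "s i = S x i" if "x \<in> Q" "i < r" for x i
      using Q(1) that by (auto simp: fun_eq_iff) 
    have qX: "x \<in> X" if "x \<in> Q" for x using that Q(1) by auto
    have s: "s i \<subseteq> P i \<and> card (s i) = t" if "i < r" for i
      using S[OF qX[OF q] that] s_eq[OF q that] by simp
    have sQ: "R x y" if "x \<in> Q" "i < r" "y \<in> s i" for x y i
      using S[OF qX[OF that(1)] that(2)] s_eq[OF that(1,2)] that(3) by auto
    have ss: "R x y" if "i < r" "j < r" "i \<noteq> j" "x \<in> s i" "y \<in> s j" for i j x y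
      using PR[OF that(1-3)] s[OF that(1)] s[OF that(2)] that(4,5) by auto
    show ?thesis unfolding has_multipartite_def
    proof (intro exI[of _ "s(r := Q)"] conjI allI impI)
      fix i assume i: "i < Suc r"
      show "(s(r := Q)) i \<subseteq> V"
        using s[of i] P[of i] Q(1) X(1) i by (cases "i = r") auto
      show "card ((s(r := Q)) i) = t"
        using s[of i] Q(2) i by (cases "i = r") auto
    next
      fix i j assume "i < Suc r" "j < Suc r" "i \<noteq> j"
      then show "\<forall>x\<in>(s(r := Q)) i. \<forall>y\<in>(s(r := Q)) j. R x y"
        using ss[of i j] sQ[of _ i] sQ[of _ j] sympD[OF R]
        by (cases "i = r"; cases "j = r") (auto simp: less_Suc_eq)
    qed
  qed
qed

text \<open>The parts of the multipartite graph need not be independent sets, so vertices of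
  the multipartite graph supplied by the induction hypothesis may be used again.\<close>

lemma erdos_stone_min_degree:
  assumes "0 < \<delta>" "\<delta> < (1::real)"
  shows "\<exists>k0. \<forall>(V::'a set) R. finite V \<longrightarrow> symp R \<longrightarrow> k0 \<le> card V \<longrightarrow>
    (\<forall>v\<in>V. real m * card {w\<in>V. \<not> R v w} \<le> (1 - \<delta>) * card V) \<longrightarrow>
    has_multipartite R V (Suc m) t"
proof (induction m arbitrary: t)
  case 0
  show ?case
  proof (intro exI[of _ t] allI impI)
    fix V :: "'a set" and R assume "t \<le> card V"
    then obtain S where "S \<subseteq> V" "card S = t" by (meson obtain_subset_with_card_n)
    then show "has_multipartite R V (Suc 0) t"
      unfolding has_multipartite_def by (intro exI[of _ "\<lambda>_. S"]) auto
  qed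
next
  case (Suc m)
  \<comment> \<open>Larger parts to shrink from: \<open>t\<close> is at most the fraction \<delta>/2
    of \<open>T\<close>. The added 1 keeps \<open>T\<close> positive when \<open>t = 0\<close>, so
    that it can be cancelled later.\<close>
  define T where "T = nat \<lceil>2 * real t / \<delta>\<rceil> + 1"
  have T: "real t \<le> \<delta> / 2 * real T" "0 < T"
  proof -
    have "2 * real t / \<delta> \<le> real T" unfolding T_def by linarith
    then show "real t \<le> \<delta> / 2 * real T" using assms by (simp add: field_simps)
  qed (simp add: T_def)
  obtain k0 where k0: "\<And>(V::'a set) R. \<lbrakk>finite V; symp R; k0 \<le> card V;
      \<forall>v\<in>V. real m * card {w\<in>V. \<not> R v w} \<le> (1 - \<delta>) * card V\<rbrakk> \<Longrightarrow>
      has_multipartite R V (Suc m) T"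
    using Suc.IH[of T] by blast
  \<comment> \<open>From this size on, the fraction \<delta>/2 of \<open>V\<close> reaches the
    pigeonhole threshold of the extension step.\<close>
  define k1 where "k1 = nat \<lceil>2 / \<delta> * real (t * (2 ^ T) ^ Suc m)\<rceil>"
  show ?case
  proof (intro exI[of _ "max k0 k1"] allI impI)
    fix V :: "'a set" and R
    assume V: "finite V" and R: "symp R" and k: "max k0 k1 \<le> card V"
      and deg: "\<forall>v\<in>V. real (Suc m) * card {w\<in>V. \<not> R v w} \<le> (1 - \<delta>) * card V"
    have "\<forall>v\<in>V. real m * card {w\<in>V. \<not> R v w} \<le> (1 - \<delta>) * card V"
      using deg by (auto simp: algebra_simps intro: order_trans[rotated])
    with k0[OF V R] k have "has_multipartite R V (Suc m) T" by auto
    then obtain P where "\<forall>i<Suc m. P i \<subseteq> V \<and> card (P i) = T"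
      and "\<forall>i<Suc m. \<forall>j<Suc m. i \<noteq> j \<longrightarrow> (\<forall>x\<in>P i. \<forall>y\<in>P j. R x y)"
      unfolding has_multipartite_def by (elim exE conjE)
    then have P: "\<And>i. i < Suc m \<Longrightarrow> P i \<subseteq> V \<and> card (P i) = T"
      and PR: "\<And>i j x y. \<lbrakk>i < Suc m; j < Suc m; i \<noteq> j; x \<in> P i; y \<in> P j\<rbrakk> \<Longrightarrow> R x y"
      by blast+
    have finP: "finite (P i)" if "i < Suc m" for i using P[OF that] V finite_subset by blast
    \<comment> \<open>The vertices able to extend the parts. The aim is that they make up at least
      the fraction \<delta>/2 of \<open>V\<close>.\<close>
    define X where "X = {x\<in>V. \<forall>i<Suc m. t \<le> card {w \<in> P i. R x w}}"
    define non where "non i x = card {w \<in> P i. \<not> R x w}" for i x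
    have XV: "X \<subseteq> V" by (auto simp: X_def)
    have split: "card {w \<in> P i. R x w} + non i x = T" if "i < Suc m" for i x
    proof -
      have "card ({w \<in> P i. R x w} \<union> {w \<in> P i. \<not> R x w}) = card {w \<in> P i. R x w} + non i x"
        unfolding non_def using finP[OF that] by (intro card_Un_disjoint) auto
      moreover have "{w \<in> P i. R x w} \<union> {w \<in> P i. \<not> R x w} = P i" by auto
      ultimately show ?thesis using P[OF that] by simp
    qed
    have lower: "real T - real t \<le> (\<Sum>i<Suc m. real (non i x))" if "x \<in> V - X" for x
    proof -
      obtain i where i: "i < Suc m" "card {w \<in> P i. R x w} < t"
        using \<open>x \<in> V - X\<close> by (auto simp: X_def not_le)
      then have "real T - real t \<le> real (non i x)" using split[OF i(1), of x] by linarith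
      also have "\<dots> \<le> (\<Sum>i<Suc m. real (non i x))"
        using i by (intro member_le_sum) auto
      finally show ?thesis .
    qed
    \<comment> \<open>Double counting of the non-adjacent pairs between \<open>V\<close> and the
      parts. Each vertex outside \<open>X\<close> has at least \<open>T - t\<close> non-neighbours
      in some part; conversely each of the \<open>Suc m * T\<close> places in the parts has few
      non-neighbours by \<open>deg\<close>.\<close>
    have "real (card (V - X)) * (real T - real t) = (\<Sum>x\<in>V - X. real T - real t)" by simp
    also have "\<dots> \<le> (\<Sum>x\<in>V - X. \<Sum>i<Suc m. real (non i x))"
      by (intro sum_mono lower)
    also have "\<dots> \<le> (\<Sum>x\<in>V. \<Sum>i<Suc m. real (non i x))"
      using V by (intro sum_mono2 sum_nonneg) auto
    also have "\<dots> = (\<Sum>i<Suc m. \<Sum>x\<in>V. \<Sum>w\<in>P i. if R x w then 0 else 1)"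
      unfolding non_def by (subst sum.swap, intro sum.cong refl)
        (use finP in \<open>auto simp: sum.If_cases Int_def Compl_eq\<close>)
    also have "\<dots> = (\<Sum>i<Suc m. \<Sum>w\<in>P i. \<Sum>x\<in>V. if R x w then 0 else 1)"
      by (intro sum.cong refl sum.swap)
    also have "\<dots> = (\<Sum>i<Suc m. \<Sum>w\<in>P i. real (card {x\<in>V. \<not> R w x}))"
      using V sympD[OF R]
      by (intro sum.cong refl) (auto simp: sum.If_cases Int_def Compl_eq intro!: arg_cong[of _ _ card])
    also have "\<dots> \<le> (\<Sum>i<Suc m. \<Sum>w\<in>P i. (1 - \<delta>) * card V / Suc m)"
    proof (intro sum_mono)
      fix i w assume "i \<in> {..<Suc m}" "w \<in> P i"
      then have "w \<in> V" using P by auto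
      with deg have "real (Suc m) * card {x\<in>V. \<not> R w x} \<le> (1 - \<delta>) * card V" by blast
      then show "real (card {x\<in>V. \<not> R w x}) \<le> (1 - \<delta>) * card V / Suc m"
        by (simp add: pos_le_divide_eq mult.commute del: of_nat_Suc)
    qed
    also have "\<dots> = (\<Sum>i<Suc m. T * ((1 - \<delta>) * card V / Suc m))"
      using P by (intro sum.cong refl) auto
    also have "\<dots> = T * ((1 - \<delta>) * card V)" by (simp del: of_nat_Suc sum.lessThan_Suc)
    finally have bound: "real (card (V - X)) * (real T - real t) \<le> T * ((1 - \<delta>) * card V)" .
    \<comment> \<open>The choice of \<open>T\<close> gives \<open>T - t\<close> \<ge> (1 -
      \<delta>/2) \<open>T\<close>, so \<open>T\<close> cancels and \<open>V - X\<close> cannot be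
      almost all of \<open>V\<close>.\<close>
    have "real T * (card (V - X) * (1 - \<delta> / 2)) \<le> real (card (V - X)) * (real T - real t)"
      using mult_left_mono[OF T(1), of "real (card (V - X))"] by (simp add: algebra_simps)
    with bound have "real T * (card (V - X) * (1 - \<delta> / 2)) \<le> T * ((1 - \<delta>) * card V)"
      by linarith
    then have "card (V - X) * (1 - \<delta> / 2) \<le> (1 - \<delta>) * card V"
      using T(2) by simp
    moreover have "real (card V) = card (V - X) + card X"
      using card_Diff_subset[of X V] XV V card_mono[OF V XV] finite_subset by fastforce
    ultimately have "\<delta> / 2 * card V \<le> (1 - \<delta> / 2) * card X"
      by (simp add: algebra_simps)
    also have "\<dots> \<le> card X" using assms by (simp add: mult_left_le_one_le)
    finally have "\<delta> / 2 * card V \<le> card X" .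
    moreover have "2 / \<delta> * real (t * (2 ^ T) ^ Suc m) \<le> card V"
      using k unfolding k1_def by linarith
    then have "real (t * (2 ^ T) ^ Suc m) \<le> \<delta> / 2 * card V"
      using assms by (simp add: field_simps)
    ultimately have "real (t * (2 ^ T) ^ Suc m) \<le> real (card X)" by linarith
    then have "t * (2 ^ T) ^ Suc m \<le> card X" unfolding of_nat_le_iff .
    moreover have "t \<le> card {w \<in> P i. R x w}" if "x \<in> X" "i < Suc m" for x i
      using that by (simp add: X_def)
    ultimately show "has_multipartite R V (Suc (Suc m)) t"
      using V R P PR XV by (intro has_multipartite_Suc[where P = P and X = X and T = T])
  qed
qed

text \<open>By the minimum degree form, a large \<open>W\<close> without the multipartite graph has
  a vertex with more than the fraction (1 - \<delta>)/m of \<open>W\<close> as non-neighbours.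
  Delete it and induct: the deletions sum to the quadratic term, the linear term pays for a loss of
  one per deletion, and \<open>C\<close> covers the small sets.\<close>

lemma non_edges_lower_bound:
  assumes "0 < \<delta>" "\<delta> < (1::real)" "0 < m"
  shows "\<exists>C. \<forall>(W::'a set) H. finite W \<longrightarrow>
    \<not> has_multipartite (\<lambda>x y. {x, y} \<in> H) W (Suc m) t \<longrightarrow>
    (1 - \<delta>) / m * (real (card W))\<^sup>2 / 2 - card W - C \<le> card {e. e \<subseteq> W \<and> card e = 2 \<and> e \<notin> H}"
proof -
  obtain k0 where k0: "\<And>(V::'a set) R. \<lbrakk>finite V; symp R; k0 \<le> card V;
      \<forall>v\<in>V. real m * card {w\<in>V. \<not> R v w} \<le> (1 - \<delta>) * card V\<rbrakk> \<Longrightarrow>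
      has_multipartite R V (Suc m) t"
    using erdos_stone_min_degree[OF assms(1,2), of m t] by blast
  define c where "c = (1 - \<delta>) / m"
  have c: "0 < c" "c \<le> 1"
  proof -
    show "0 < c" using assms by (simp add: c_def)
    have "1 - \<delta> \<le> real m" using assms by linarith
    then show "c \<le> 1" using assms by (simp add: c_def)
  qed
  have "c * (real (card W))\<^sup>2 / 2 - card W - (real k0)\<^sup>2 \<le> card {e. e \<subseteq> W \<and> card e = 2 \<and> e \<notin> H}"
    if W: "finite W" and free: "\<not> has_multipartite (\<lambda>x y. {x, y} \<in> H) W (Suc m) t"
    for W :: "'a set" and H
    using W free
  proof (induction "card W" arbitrary: W rule: less_induct)
    case less
    define N where "N W = {e. e \<subseteq> W \<and> card e = 2 \<and> e \<notin> H}" for W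
    have finN: "finite (N W)" if "finite W" for W using that by (simp add: N_def)
    show ?case
    proof (cases "card W < k0")
      case True
      then have "(real (card W))\<^sup>2 \<le> (real k0)\<^sup>2" by (intro power_mono) auto
      moreover have "c * (real (card W))\<^sup>2 \<le> (real (card W))\<^sup>2"
        using c by (simp add: mult_left_le_one_le)
      ultimately have "c * (real (card W))\<^sup>2 / 2 - card W - (real k0)\<^sup>2 \<le> 0"
        using zero_le_power2[of "real k0"] by linarith
      also have "0 \<le> real (card {e. e \<subseteq> W \<and> card e = 2 \<and> e \<notin> H})" by simp
      finally show ?thesis .
    next
      case False
      have "symp (\<lambda>x y. {x, y} \<in> H)" by (simp add: symp_def insert_commute)
      with k0[of W "\<lambda>x y. {x, y} \<in> H"] False less.prems
      obtain v where v: "v \<in> W" "(1 - \<delta>) * card W < real m * card {w\<in>W. {v, w} \<notin> H}"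
        by (force simp: not_le)
      define U where "U = {w\<in>W. {v, w} \<notin> H}"
      have U: "c * card W < card U"
        using v(2) assms by (simp add: c_def U_def field_simps)
      have finU: "finite U" using less.prems by (simp add: U_def)
      \<comment> \<open>Since \<open>{v, v}\<close> is a singleton and \<open>H\<close> is
        arbitrary, \<open>U\<close> may contain \<open>v\<close>, which yields no non-edge.\<close>
      have cardU: "card U \<le> card (U - {v}) + 1"
        using card_Diff_subset_Int[of "{v}" U] finU by (cases "v \<in> U") auto
      have cardW: "card (W - {v}) = card W - 1" "0 < card W"
        using v less.prems by (auto simp: card_gt_0_iff)
      have "\<not> has_multipartite (\<lambda>x y. {x, y} \<in> H) (W - {v}) (Suc m) t"
        using less.prems has_multipartite_mono by blast
      then have IH: "c * (real (card (W - {v})))\<^sup>2 / 2 - card (W - {v}) - (real k0)\<^sup>2 \<le> card (N (W - {v}))"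
        unfolding N_def using less.hyps[of "W - {v}"] less.prems cardW by simp
      \<comment> \<open>The non-edges at \<open>v\<close> are new: those counted by the induction
        hypothesis avoid \<open>v\<close>.\<close>
      have "inj_on (\<lambda>w. {v, w}) (U - {v})"
        by (auto simp: inj_on_def doubleton_eq_iff)
      then have "card (U - {v}) = card ((\<lambda>w. {v, w}) ` (U - {v}))" by (simp add: card_image)
      also have "card (N (W - {v})) + \<dots> = card (N (W - {v}) \<union> (\<lambda>w. {v, w}) ` (U - {v}))"
        using finN less.prems finU by (intro card_Un_disjoint[symmetric]) (auto simp: N_def)
      also have "\<dots> \<le> card (N W)"
        using finN[OF less.prems(1)] v(1) by (intro card_mono) (auto simp: N_def U_def card_insert_if)
      finally have "card (N (W - {v})) + card (U - {v}) \<le> card (N W)" by simp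
      then have "real (card (N (W - {v}))) + real (card U) - 1 \<le> card (N W)"
        using cardU by linarith
      moreover have k: "real (card (W - {v})) = real (card W) - 1" using cardW by linarith
      \<comment> \<open>The loss \<open>c * card W\<close> in the square is made up by
        \<open>U\<close>; the linear term drops by one, matching the possible loss of
        \<open>v\<close>.\<close>
      have "c * (real (card (W - {v})))\<^sup>2 / 2 = c * (real (card W))\<^sup>2 / 2 - c * card W + c / 2"
        unfolding k by (simp add: power2_eq_square field_simps)
      ultimately have "c * (real (card W))\<^sup>2 / 2 - card W - (real k0)\<^sup>2 \<le> card (N W)"
        using IH U c(1) k by linarith
      then show ?thesis by (simp add: N_def)
    qed
  qed
  then show ?thesis unfolding c_def by blast
qed

subsection \<open>Diameter graphs\<close>

text \<open>The alternating sum of the four squared distances is -2 times this inner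
  product.\<close>

lemma inner_diff_eq_0_if_equidistant:
  fixes x x' y y' :: "'b::real_inner"
  assumes "dist x y = D" "dist x y' = D" "dist x' y = D" "dist x' y' = D"
  shows "(x - x') \<bullet> (y - y') = 0"
proof -
  have "(x - y) \<bullet> (x - y) = D\<^sup>2" "(x - y') \<bullet> (x - y') = D\<^sup>2"
    "(x' - y) \<bullet> (x' - y) = D\<^sup>2" "(x' - y') \<bullet> (x' - y') = D\<^sup>2"
    using assms by (auto simp: dist_norm power2_norm_eq_inner[symmetric])
  then show ?thesis by (simp add: inner_diff inner_commute)
qed

text \<open>A line meets a sphere, here centred at \<open>y\<close>, in at most two points.\<close>

lemma not_collinear_if_on_sphere:
  fixes a b c y :: "'b::real_inner"
  assumes "dist a y = D" "dist b y = D" "dist c y = D" "a \<noteq> b" "a \<noteq> c" "b \<noteq> c"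
  shows "c - a \<noteq> r *\<^sub>R (b - a)"
proof
  assume eq: "c - a = r *\<^sub>R (b - a)"
  define z u where "z = a - y" and "u = b - a"
  have "z \<bullet> z = D\<^sup>2" "(z + u) \<bullet> (z + u) = D\<^sup>2" "(z + r *\<^sub>R u) \<bullet> (z + r *\<^sub>R u) = D\<^sup>2"
    using assms(1-3) unfolding z_def u_def eq[symmetric]
    by (auto simp: dist_norm power2_norm_eq_inner[symmetric])
  then have "2 * (z \<bullet> u) + u \<bullet> u = 0" "2 * (r * (z \<bullet> u)) + r * (r * (u \<bullet> u)) = 0"
    by (auto simp: inner_add inner_commute)
  \<comment> \<open>Subtract \<open>r\<close> times the first equation from the second.\<close>
  then have "r * (r - 1) * (u \<bullet> u) = 0" by algebra
  then have "r = 0 \<or> r = 1" using assms(4) by (auto simp: u_def)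
  then show False using eq assms(5,6) by auto
qed

text \<open>Each triple lies on a sphere about a point of another triple, so it is not collinear and
  spans two independent directions. Directions from different triples are orthogonal, which makes
  \<open>2 * r\<close> nonzero orthogonal vectors, more than the dimension allows.\<close>

lemma no_multipartite_equidistant:
  fixes f :: "'a \<Rightarrow> 'b::euclidean_space"
  assumes inj: "inj_on f V" and dim: "DIM('b) < 2 * r" and r: "2 \<le> r"
    and R: "\<And>x y. \<lbrakk>x \<in> V; y \<in> V; R x y\<rbrakk> \<Longrightarrow> dist (f x) (f y) = D"
  shows "\<not> has_multipartite R V r 3"
proof
  assume "has_multipartite R V r 3"
  then obtain P where P: "\<forall>i<r. P i \<subseteq> V \<and> card (P i) = 3"
    and PR: "\<forall>i<r. \<forall>j<r. i \<noteq> j \<longrightarrow> (\<forall>x\<in>P i. \<forall>y\<in>P j. R x y)"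
    unfolding has_multipartite_def by (elim exE conjE)
  have "\<forall>i. \<exists>x y z. i < r \<longrightarrow> P i = {x, y, z} \<and> x \<noteq> y \<and> y \<noteq> z \<and> x \<noteq> z"
    using P by (auto simp: card_3_iff)
  then obtain a b c where abc: "\<And>i. i < r \<Longrightarrow> P i = {a i, b i, c i}"
      and ne: "\<And>i. i < r \<Longrightarrow> a i \<noteq> b i \<and> b i \<noteq> c i \<and> a i \<noteq> c i"
    by metis
  have inV: "a i \<in> V" "b i \<in> V" "c i \<in> V" if "i < r" for i using P abc[OF that] that by auto
  have fne: "f (a i) \<noteq> f (b i)" "f (b i) \<noteq> f (c i)" "f (a i) \<noteq> f (c i)" if "i < r" for i
    using ne[OF that] inV[OF that] inj by (auto dest: inj_onD)
  have dist: "dist (f x) (f y) = D" if "i < r" "j < r" "i \<noteq> j" "x \<in> P i" "y \<in> P j" for i j x y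
    using R P PR that by blast
  define u w where "u i = f (b i) - f (a i)" and "w i = f (c i) - f (a i)" for i
  \<comment> \<open>Gram-Schmidt inside a triple: \<open>w'\<close> is the component of
    \<open>w\<close> orthogonal to \<open>u\<close>, nonzero by non-collinearity.\<close>
  define w' where "w' i = w i - ((u i \<bullet> w i) / (u i \<bullet> u i)) *\<^sub>R u i" for i
  have u0: "u i \<noteq> 0" if "i < r" for i using fne[OF that] by (simp add: u_def)
  have w'0: "w' i \<noteq> 0" if i: "i < r" for i
  proof -
    \<comment> \<open>Any other part supplies the centre of the sphere; it exists as
      \<open>2 \<le> r\<close>.\<close>
    define j where "j = (if i = 0 then 1 else 0 :: nat)"
    have j: "j < r" "i \<noteq> j" using r by (auto simp: j_def)
    show ?thesis
      using not_collinear_if_on_sphere[of "f (a i)" "f (a j)" D "f (b i)" "f (c i)"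
          "(u i \<bullet> w i) / (u i \<bullet> u i)"] dist[OF i j] abc[OF i] abc[OF j(1)] fne[OF i]
      by (auto simp: w'_def u_def w_def)
  qed
  have cross: "u i \<bullet> u j = 0" "u i \<bullet> w j = 0" "w i \<bullet> u j = 0" "w i \<bullet> w j = 0"
    if ij: "i < r" "j < r" "i \<noteq> j" for i j
    unfolding u_def w_def
    by (intro inner_diff_eq_0_if_equidistant[where D = D] dist[OF ij];
        simp add: abc[OF ij(1)] abc[OF ij(2)])+
  have same: "u i \<bullet> w' i = 0" if "i < r" for i
    using u0[OF that] by (simp add: w'_def inner_diff)
  define e where "e = (\<lambda>(i, s). if s then u i else w' i)"
  have e0: "e q \<noteq> 0" if "q \<in> {..<r} \<times> UNIV" for q using that u0 w'0 by (auto simp: e_def split: if_splits)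
  have orth: "e q \<bullet> e q' = 0" if "q \<in> {..<r} \<times> UNIV" "q' \<in> {..<r} \<times> UNIV" "q \<noteq> q'" for q q'
  proof -
    obtain i s j s' where q: "q = (i, s)" "q' = (j, s')" by fastforce
    show ?thesis
    proof (cases "i = j")
      case True
      then show ?thesis using that same[of i] by (auto simp: q e_def inner_commute)
    next
      case False
      then show ?thesis using that cross[of i j]
        by (auto simp: q e_def w'_def inner_diff)
    qed
  qed
  \<comment> \<open>Equal vectors at different indices would be orthogonal to themselves, hence
    zero.\<close>
  have "inj_on e ({..<r} \<times> UNIV)"
    by (rule inj_onI) (metis orth e0 inner_eq_zero_iff)
  then have "card (e ` ({..<r} \<times> UNIV)) = 2 * r" by (simp add: card_image card_cartesian_product)
  moreover have "pairwise orthogonal (e ` ({..<r} \<times> UNIV))"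
    unfolding pairwise_image pairwise_def orthogonal_def using orth by blast
  then have "independent (e ` ({..<r} \<times> UNIV))"
    using e0 by (intro pairwise_orthogonal_independent) (auto simp: image_iff)
  then have "card (e ` ({..<r} \<times> UNIV)) \<le> DIM('b)" by (rule independent_card_le)
  ultimately show False using dim by simp
qed

lemma non_edges_diameter_graph:
  assumes "0 < \<delta>" "\<delta> < (1::real)" "CARD('d::finite) \<ge> 2"
  shows "\<exists>C. \<forall>W H. H \<subseteq> {e. e \<subseteq> W \<and> card e = 2} \<longrightarrow> diameter_graph TYPE('d) W H \<longrightarrow>
    (1 - \<delta>) / real (CARD('d) div 2) * (real (card W))\<^sup>2 / 2 - card W - C
      \<le> card {e. e \<subseteq> W \<and> card e = 2 \<and> e \<notin> H}"
proof -
  define m where "m = CARD('d) div 2"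
  have m: "0 < m" "CARD('d) < 2 * Suc m" using assms(3) by (auto simp: m_def)
  obtain C where C: "\<And>(W::nat set) H. \<lbrakk>finite W;
      \<not> has_multipartite (\<lambda>x y. {x, y} \<in> H) W (Suc m) 3\<rbrakk> \<Longrightarrow>
    (1 - \<delta>) / m * (real (card W))\<^sup>2 / 2 - card W - C \<le> card {e. e \<subseteq> W \<and> card e = 2 \<and> e \<notin> H}"
    using non_edges_lower_bound[OF assms(1,2) m(1), of 3] by blast
  have free: "\<not> has_multipartite (\<lambda>x y. {x, y} \<in> H) W (Suc m) 3"
    if H: "H \<subseteq> {e. e \<subseteq> W \<and> card e = 2}" and dg: "diameter_graph TYPE('d) W H" for W H
  proof -
    obtain f :: "nat \<Rightarrow> real^'d" where f: "inj_on f W"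
      "\<forall>x\<in>W. \<forall>y\<in>W. x \<noteq> y \<longrightarrow> ({x, y} \<in> H \<longleftrightarrow> dist (f x) (f y) = diameter (f ` W))"
      using dg unfolding diameter_graph_def by blast
    \<comment> \<open>The correspondence between edges and distances speaks of distinct vertices
      only.\<close>
    have "x \<noteq> y" if "{x, y} \<in> H" for x y using H that by auto
    then show ?thesis
      using f m by (intro no_multipartite_equidistant[where f = f and D = "diameter (f ` W)"])
        (auto dest: bspec)
  qed
  show ?thesis
    unfolding m_def[symmetric]
  proof (intro exI[of _ C] allI impI)
    fix W H assume "H \<subseteq> {e. e \<subseteq> W \<and> card e = 2}" and dg: "diameter_graph TYPE('d) W H"
    moreover have "finite W" using dg by (simp add: diameter_graph_def)
    ultimately show "(1 - \<delta>) / m * (real (card W))\<^sup>2 / 2 - card W - C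
        \<le> card {e. e \<subseteq> W \<and> card e = 2 \<and> e \<notin> H}"
      by (intro C free)
  qed
qed

section \<open>Counting labelled diameter graphs\<close>

text \<open>The edges are the pairs at which the squared distance minus \<open>D\<^sup>2\<close>
  vanishes. These are at most \<open>k\<^sup>2\<close> polynomials of degree at most 2 in each of
  \<open>CARD('d) * k + 1\<close> variables, so zero patterns bound the count.\<close>

lemma card_diameter_graphs_le:
  assumes W: "finite W" "card W = k"
  shows "card {H. H \<subseteq> {e. e \<subseteq> W \<and> card e = 2} \<and> diameter_graph TYPE('d::finite) W H}
    \<le> (2 * k\<^sup>2 + 1) ^ (CARD('d) * k + 1)"
proof -
  define J where "J = {(x, y). x \<in> W \<and> y \<in> W \<and> x < y}"
  \<comment> \<open>\<open>None\<close> names the variable \<open>D\<close> for the diameter,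
    \<open>Some (x, l)\<close> the coordinate \<open>l\<close> of the image of
    \<open>x\<close>.\<close>
  define I where "I = insert None (Some ` (W \<times> (UNIV :: 'd set)))"
  define v :: "(nat \<times> 'd) option \<Rightarrow> (nat \<Rightarrow> real^'d) \<times> real \<Rightarrow> real"
    where "v i = (\<lambda>(f, D). case i of None \<Rightarrow> D | Some (x, l) \<Rightarrow> f x $ l)" for i
  define F :: "nat \<times> nat \<Rightarrow> (nat \<Rightarrow> real^'d) \<times> real \<Rightarrow> real"
    where "F j = (\<lambda>(f, D). (\<Sum>l\<in>UNIV. (f (fst j) $ l - f (snd j) $ l)\<^sup>2) - D\<^sup>2)" for j
  \<comment> \<open>\<open>q\<close> ranges over all pairs of a map and a real, so patterns in which
    \<open>D\<close> is not the diameter are counted too; an upper bound tolerates this.\<close>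
  define Z where "Z q = {j\<in>J. F j q \<noteq> 0}" for q
  have J: "finite J" "card J \<le> k\<^sup>2"
  proof -
    have sub: "J \<subseteq> W \<times> W" by (auto simp: J_def)
    then show "finite J" using W finite_subset by blast
    show "card J \<le> k\<^sup>2"
      using card_mono[OF _ sub] W by (simp add: card_cartesian_product power2_eq_square)
  qed
  have I: "finite I" "card I = CARD('d) * k + 1"
    using W by (auto simp: I_def card_image card_cartesian_product)
  have sq: "(\<lambda>x. (g x)\<^sup>2) \<in> poly_space v I 2" if "g \<in> poly_space v I 1" for g
    using poly_space_mult[OF that that] by (simp add: power2_eq_square numeral_2_eq_2)
  have F: "F j \<in> poly_space v I 2" if "j \<in> J" for j
  proof -
    obtain x y where j: "j = (x, y)" "x \<in> W" "y \<in> W" using \<open>j \<in> J\<close> by (auto simp: J_def)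
    have "(\<lambda>q. (\<Sum>l\<in>UNIV. (v (Some (x, l)) q - v (Some (y, l)) q)\<^sup>2) - (v None q)\<^sup>2) \<in> poly_space v I 2"
      using j I(1) by (intro poly_space_diff poly_space_sum sq poly_space_variable) (auto simp: I_def)
    also have "(\<lambda>q. (\<Sum>l\<in>UNIV. (v (Some (x, l)) q - v (Some (y, l)) q)\<^sup>2) - (v None q)\<^sup>2) = F j"
      by (auto simp: F_def v_def j)
    finally show ?thesis .
  qed
  have "H \<in> (\<lambda>S. (\<lambda>(x, y). {x, y}) ` (J - S)) ` range Z"
    if H: "H \<subseteq> {e. e \<subseteq> W \<and> card e = 2}" and dg: "diameter_graph TYPE('d) W H" for H
  proof -
    obtain f :: "nat \<Rightarrow> real^'d" where f:
      "\<forall>x\<in>W. \<forall>y\<in>W. x \<noteq> y \<longrightarrow> ({x, y} \<in> H \<longleftrightarrow> dist (f x) (f y) = diameter (f ` W))"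
      using dg unfolding diameter_graph_def by blast
    \<comment> \<open>Nonnegativity lets equality of distances be tested on squares, which are
      polynomial.\<close>
    have D0: "0 \<le> diameter (f ` W)" using W by (intro diameter_ge_0 finite_imp_bounded) auto
    have edge: "{x, y} \<in> H \<longleftrightarrow> F (x, y) (f, diameter (f ` W)) = 0" if "(x, y) \<in> J" for x y
    proof -
      have "(dist (f x) (f y))\<^sup>2 = (\<Sum>l\<in>UNIV. (f x $ l - f y $ l)\<^sup>2)"
        unfolding dist_norm power2_norm_eq_inner by (simp add: inner_vec_def power2_eq_square)
      moreover have "dist (f x) (f y) = diameter (f ` W) \<longleftrightarrow>
          (dist (f x) (f y))\<^sup>2 = (diameter (f ` W))\<^sup>2"
        using D0 by (simp add: power2_eq_iff_nonneg)
      ultimately show ?thesis using f that by (auto simp: F_def J_def)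
    qed
    have "H = (\<lambda>(x, y). {x, y}) ` (J - Z (f, diameter (f ` W)))"
    proof (intro equalityI subsetI)
      fix e assume e: "e \<in> H"
      then obtain a b where ab: "e = {a, b}" "a \<noteq> b" "a \<in> W" "b \<in> W"
        using H by (auto simp: card_2_iff)
      define x y where "x = min a b" and "y = max a b"
      have xy: "e = {x, y}" "(x, y) \<in> J"
        using ab by (auto simp: x_def y_def J_def min_def max_def)
      with e edge show "e \<in> (\<lambda>(x, y). {x, y}) ` (J - Z (f, diameter (f ` W)))"
        by (auto simp: Z_def intro!: image_eqI[of _ _ "(x, y)"])
    next
      fix e assume "e \<in> (\<lambda>(x, y). {x, y}) ` (J - Z (f, diameter (f ` W)))"
      then show "e \<in> H" using edge by (auto simp: Z_def)
    qed
    then show ?thesis by blast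
  qed
  then have sub: "{H. H \<subseteq> {e. e \<subseteq> W \<and> card e = 2} \<and> diameter_graph TYPE('d) W H}
      \<subseteq> (\<lambda>S. (\<lambda>(x, y). {x, y}) ` (J - S)) ` range Z" by blast
  have finZ: "finite (range Z)"
    by (rule finite_subset[of _ "Pow J"]) (use J in \<open>auto simp: Z_def\<close>)
  have "card {H. H \<subseteq> {e. e \<subseteq> W \<and> card e = 2} \<and> diameter_graph TYPE('d) W H} \<le> card (range Z)"
    using card_mono[OF _ sub] card_image_le[OF finZ] finZ by (meson finite_imageI order_trans)
  also have "\<dots> \<le> (2 * card J + 1) ^ card I"
    unfolding Z_def by (rule card_poly_zero_patterns_le[OF J(1) I(1) F])
  also have "\<dots> \<le> (2 * k\<^sup>2 + 1) ^ (CARD('d) * k + 1)"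
    unfolding I(2) using J(2) by (intro power_mono) auto
  finally show ?thesis .
qed

subsection \<open>The random graph\<close>

lemma finite_all_pairs: "finite (all_pairs n)"
  by (rule finite_subset[of _ "Pow {0..<n}"]) (auto simp: all_pairs_def)

text \<open>Expand the product of \<open>p + (1 - p)\<close> over \<open>A\<close>.\<close>

lemma sum_Pow_bernoulli_weights:
  fixes p :: real
  assumes "finite A"
  shows "(\<Sum>F\<in>Pow A. p ^ card F * (1 - p) ^ (card A - card F)) = 1"
proof -
  have "(\<Sum>F\<in>Pow A. p ^ card F * (1 - p) ^ (card A - card F)) =
      (\<Sum>F\<in>Pow A. (\<Prod>x\<in>F. p) * (\<Prod>x\<in>A - F. 1 - p))"
    using assms by (intro sum.cong refl) (auto simp: card_Diff_subset finite_subset)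
  also have "\<dots> = (\<Prod>x\<in>A. p + (1 - p))" by (rule prod_add[OF assms, symmetric])
  finally show ?thesis by simp
qed

text \<open>The pairs inside \<open>W\<close> are prescribed and all others are free, so the
  probability is \<open>p\<close> to the number of edges times \<open>1 - p\<close> to the number of
  non-edges; the first factor is at most 1.\<close>

lemma Pnp_induced_eq_le:
  assumes p: "0 < p" "p < 1" and W: "W \<subseteq> {0..<n}" and H: "H \<subseteq> {e. e \<subseteq> W \<and> card e = 2}"
  shows "Pnp n p (\<lambda>E. induced E W = H) \<le> (1 - p) ^ card {e. e \<subseteq> W \<and> card e = 2 \<and> e \<notin> H}"
proof -
  define A B where "A = all_pairs n" and "B = {e. e \<subseteq> W \<and> card e = 2}"
  have A: "finite A" by (simp add: A_def finite_all_pairs)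
  have BA: "B \<subseteq> A" using W by (auto simp: A_def B_def all_pairs_def)
  have HB: "H \<subseteq> B" using H by (simp add: B_def)
  have fin: "finite B" "finite H" using A BA HB by (meson finite_subset)+
  \<comment> \<open>Such an \<open>E\<close> is \<open>H\<close> together with an arbitrary set of
    pairs not inside \<open>W\<close>.\<close>
  have "{E. E \<subseteq> A \<and> induced E W = H} = (\<union>) H ` Pow (A - B)"
  proof (intro equalityI subsetI)
    fix E assume E: "E \<in> {E. E \<subseteq> A \<and> induced E W = H}"
    then have "H = E \<inter> B" by (auto simp: induced_def A_def B_def all_pairs_def)
    then show "E \<in> (\<union>) H ` Pow (A - B)" using E by (intro image_eqI[of _ _ "E - B"]) auto
  next
    fix E assume "E \<in> (\<union>) H ` Pow (A - B)"
    then obtain F where F: "F \<subseteq> A - B" "E = H \<union> F" by auto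
    have "\<not> e \<subseteq> W" if "e \<in> F" for e using F that by (auto simp: A_def B_def all_pairs_def)
    then have "induced E W = H" using F HB by (auto simp: induced_def B_def)
    then show "E \<in> {E. E \<subseteq> A \<and> induced E W = H}" using F BA HB by auto
  qed
  moreover have "inj_on ((\<union>) H) (Pow (A - B))" using HB by (auto simp: inj_on_def)
  ultimately have "Pnp n p (\<lambda>E. induced E W = H) =
      (\<Sum>F\<in>Pow (A - B). p ^ card (H \<union> F) * (1 - p) ^ (card A - card (H \<union> F)))"
    by (simp add: Pnp_def A_def[symmetric] sum.reindex)
  also have "\<dots> = (\<Sum>F\<in>Pow (A - B). p ^ card H * (1 - p) ^ card (B - H) *
      (p ^ card F * (1 - p) ^ (card (A - B) - card F)))"
  proof (intro sum.cong refl)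
    fix F assume "F \<in> Pow (A - B)"
    then have F: "F \<subseteq> A - B" "finite F" using A finite_subset by auto
    have "card (H \<union> F) = card H + card F"
      using F HB fin by (intro card_Un_disjoint) auto
    moreover have "card A = card (A - B) + card B" "card B = card (B - H) + card H"
      using A BA HB fin by (auto simp: card_Diff_subset card_mono)
    moreover have "card F \<le> card (A - B)" using F A by (intro card_mono) auto
    ultimately have "card (H \<union> F) = card H + card F"
        "card A - card (H \<union> F) = card (B - H) + (card (A - B) - card F)" by linarith+
    then show "p ^ card (H \<union> F) * (1 - p) ^ (card A - card (H \<union> F)) =
        p ^ card H * (1 - p) ^ card (B - H) * (p ^ card F * (1 - p) ^ (card (A - B) - card F))"
      by (simp add: power_add)
  qed
  also have "\<dots> = p ^ card H * (1 - p) ^ card (B - H)"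
    using A by (simp add: sum_distrib_left[symmetric] sum_Pow_bernoulli_weights)
  also have "\<dots> \<le> 1 * (1 - p) ^ card (B - H)"
    using p by (intro mult_right_mono) (auto simp: power_le_one)
  also have "B - H = {e. e \<subseteq> W \<and> card e = 2 \<and> e \<notin> H}" by (auto simp: B_def)
  finally show ?thesis by simp
qed

lemma Pnp_union_bound:
  assumes p: "0 \<le> p" "p \<le> 1" and I: "finite I"
    and Q: "\<And>E. \<lbrakk>E \<subseteq> all_pairs n; Q E\<rbrakk> \<Longrightarrow> \<exists>i\<in>I. S i E"
  shows "Pnp n p Q \<le> (\<Sum>i\<in>I. Pnp n p (S i))"
proof -
  define wt where "wt E = p ^ card E * (1 - p) ^ (card (all_pairs n) - card E)" for E :: "nat set set"
  have wt: "0 \<le> wt E" for E using p by (simp add: wt_def)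
  have fin: "finite {E. E \<subseteq> all_pairs n \<and> X E}" for X
    by (rule finite_subset[of _ "Pow (all_pairs n)"]) (auto simp: finite_all_pairs)
  have Pnp: "Pnp n p X = (\<Sum>E\<in>Pow (all_pairs n). if X E then wt E else 0)" for X
    unfolding Pnp_def wt_def[symmetric]
    using fin finite_all_pairs by (intro sum.mono_neutral_cong_left) auto
  have "(if Q E then wt E else 0) \<le> (\<Sum>i\<in>I. if S i E then wt E else 0)"
    if "E \<in> Pow (all_pairs n)" for E
  proof (cases "Q E")
    case True
    with Q that obtain i where i: "i \<in> I" "S i E" by blast
    then have "wt E = (if S i E then wt E else 0)" by simp
    also have "\<dots> \<le> (\<Sum>i\<in>I. if S i E then wt E else 0)"
      using i I wt by (intro member_le_sum) auto
    finally show ?thesis using True by simp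
  qed (auto intro!: sum_nonneg simp: wt)
  then have "Pnp n p Q \<le> (\<Sum>E\<in>Pow (all_pairs n). \<Sum>i\<in>I. if S i E then wt E else 0)"
    unfolding Pnp by (intro sum_mono)
  also have "\<dots> = (\<Sum>i\<in>I. Pnp n p (S i))" unfolding Pnp by (rule sum.swap)
  finally show ?thesis .
qed

text \<open>Union bound over the at most \<open>n ^ k\<close> vertex sets and the labelled diameter
  graphs on each. The exponent \<open>s\<close> is real, possibly negative, whence
  \<open>powr\<close>.\<close>

lemma Pnp_good_event_le:
  assumes p: "0 < p" "p < 1"
    and s: "\<And>W H. \<lbrakk>card W = k; H \<subseteq> {e. e \<subseteq> W \<and> card e = 2}; diameter_graph TYPE('d::finite) W H\<rbrakk>
      \<Longrightarrow> s \<le> real (card {e. e \<subseteq> W \<and> card e = 2 \<and> e \<notin> H})"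
  shows "Pnp n p (good_event TYPE('d) conn n k)
    \<le> real n ^ k * (2 * real k ^ 2 + 1) ^ (CARD('d) * k + 1) * (1 - p) powr s"
proof -
  define \<W> where "\<W> = {W. W \<subseteq> {0..<n} \<and> card W = k}"
  define \<H> where "\<H> W = {H. H \<subseteq> {e. e \<subseteq> W \<and> card e = 2} \<and> diameter_graph TYPE('d) W H}" for W
  define N where "N = (2 * k\<^sup>2 + 1) ^ (CARD('d) * k + 1)"
  have finW: "finite \<W>" by (simp add: \<W>_def)
  have finW': "finite W" if "W \<in> \<W>" for W using that finite_subset by (auto simp: \<W>_def)
  have finH: "finite (\<H> W)" if "W \<in> \<W>" for W
    by (rule finite_subset[of _ "Pow (Pow W)"]) (use finW'[OF that] in \<open>auto simp: \<H>_def\<close>)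
  have "card \<W> \<le> n ^ k"
    using binomial_le_pow[of k n] by (cases "k \<le> n") (auto simp: \<W>_def n_subsets binomial_eq_0)
  moreover have cardH: "card (\<H> W) \<le> N" if "W \<in> \<W>" for W
    using card_diameter_graphs_le[OF finW'[OF that], of k, where 'd = 'd] that
    by (simp add: \<W>_def \<H>_def N_def)
  have cardS: "card (Sigma \<W> \<H>) \<le> card \<W> * N"
    using finW finH sum_bounded_above[of \<W> "\<lambda>W. card (\<H> W)" N] cardH by simp
  ultimately have card: "card (Sigma \<W> \<H>) \<le> n ^ k * N"
    by (meson mult_le_mono1 order_trans)
  have "Pnp n p (good_event TYPE('d) conn n k) \<le>
      (\<Sum>(W, H)\<in>Sigma \<W> \<H>. Pnp n p (\<lambda>E. induced E W = H))"
    unfolding case_prod_unfold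
  proof (rule Pnp_union_bound)
    show "finite (Sigma \<W> \<H>)" using finW finH by simp
    fix E assume E: "E \<subseteq> all_pairs n" "good_event TYPE('d) conn n k E"
    then obtain W where "W \<subseteq> {0..<n}" "card W = k" "diameter_graph TYPE('d) W (induced E W)"
      unfolding good_event_def by blast
    moreover have "induced E W \<subseteq> {e. e \<subseteq> W \<and> card e = 2}"
      using E by (auto simp: induced_def all_pairs_def)
    ultimately show "\<exists>i\<in>Sigma \<W> \<H>. induced E (fst i) = snd i"
      by (intro bexI[of _ "(W, induced E W)"]) (auto simp: \<W>_def \<H>_def)
  qed (use p in auto)
  also have "\<dots> \<le> (\<Sum>(W, H)\<in>Sigma \<W> \<H>. (1 - p) powr s)"
  proof (rule sum_mono, clarify)
    fix W H assume W: "W \<in> \<W>" and H: "H \<in> \<H> W"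
    let ?N = "card {e. e \<subseteq> W \<and> card e = 2 \<and> e \<notin> H}"
    have "Pnp n p (\<lambda>E. induced E W = H) \<le> (1 - p) ^ ?N"
      using W H p by (intro Pnp_induced_eq_le) (auto simp: \<W>_def \<H>_def)
    also have "\<dots> = (1 - p) powr real ?N" using p by (simp add: powr_realpow)
    also have "\<dots> \<le> (1 - p) powr s"
      using W H p s by (intro powr_mono') (auto simp: \<W>_def \<H>_def)
    finally show "Pnp n p (\<lambda>E. induced E W = H) \<le> (1 - p) powr s" .
  qed
  also have "\<dots> = real (card (Sigma \<W> \<H>)) * (1 - p) powr s" by (simp add: case_prod_unfold)
  also have "\<dots> \<le> real (n ^ k * N) * (1 - p) powr s"
    using card by (intro mult_right_mono) (simp_all only: of_nat_le_iff powr_ge_zero)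
  also have "real (n ^ k * N) = real n ^ k * (2 * real k ^ 2 + 1) ^ (CARD('d) * k + 1)"
    by (simp only: N_def of_nat_mult of_nat_power of_nat_add of_nat_numeral of_nat_1)
  finally show ?thesis .
qed

section \<open>Asymptotics of the union bound\<close>

text \<open>The expression is the shape of the logarithm of the union bound once \<open>n\<close> is
  eliminated; its quadratic term dominates k log k. The target -1 serves because exp(-1) \<le>
  1/2.\<close>

lemma eventually_union_bound_small:
  fixes A :: real
  assumes "0 < A"
  shows "\<forall>\<^sub>F k in sequentially. - A * real k ^ 2 + B * real k + C
    + (D * real k + 1) * ln (2 * real k ^ 2 + 1) < - 1"
proof -
  have "filterlim (\<lambda>k. - A * real k ^ 2 + B * real k + C
      + (D * real k + 1) * ln (2 * real k ^ 2 + 1)) at_bot sequentially"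
    using assms by real_asymp
  then show ?thesis by (simp add: filterlim_at_bot_dense)
qed

text \<open>The lower bound on \<open>k\<close> bounds ln n by a multiple of \<open>k\<close> plus a
  constant, which removes \<open>n\<close> from the union bound. Hence one \<open>k0\<close> serves
  all \<open>n\<close>.\<close>

lemma good_event_unlikely:
  assumes p: "0 < p" "p < 1" and d: "CARD('d::finite) \<ge> 2" and eps: "\<epsilon> > 0"
  shows "\<exists>k0. \<forall>k\<ge>k0. \<forall>n>0. \<forall>conn.
    (2 + \<epsilon>) * real (CARD('d) div 2) * log (1 / (1 - p)) (real n * p) < real k \<longrightarrow>
    Pnp n p (good_event TYPE('d) conn n k) \<le> 1 / 2"
proof -
  define m where "m = real (CARD('d) div 2)"
  define d' where "d' = real CARD('d)"
  define L where "L = - ln (1 - p)"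
  \<comment> \<open>Chosen so that (1 - \<delta>)(2 + \<epsilon>) = 2 + \<epsilon>/2, which exceeds
    2.\<close>
  define \<delta> where "\<delta> = \<epsilon> / 2 / (2 + \<epsilon>)"
  \<comment> \<open>Net quadratic gain: the exponent from the non-edges minus the cost of choosing
    the vertex set.\<close>
  define A where "A = L * ((1 - \<delta>) / m / 2 - 1 / ((2 + \<epsilon>) * m))"
  have m: "0 < m" using d by (simp add: m_def)
  have L: "0 < L" using p by (simp add: L_def)
  have \<delta>: "0 < \<delta>" "\<delta> < 1" using eps by (auto simp: \<delta>_def field_simps)
  have "\<delta> * (2 + \<epsilon>) = \<epsilon> / 2" unfolding \<delta>_def using eps by (intro nonzero_eq_divide_eq[THEN iffD1]) auto
  then have "2 < (1 - \<delta>) * (2 + \<epsilon>)" using eps by (simp add: algebra_simps)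
  then have "2 / (2 + \<epsilon>) < 1 - \<delta>" using eps by (simp add: pos_divide_less_eq)
  then have "2 / (2 + \<epsilon>) / (2 * m) < (1 - \<delta>) / (2 * m)"
    using m by (intro divide_strict_right_mono) auto
  then have A: "0 < A" using L by (simp add: A_def mult.commute)
  obtain C where C: "\<And>W H. \<lbrakk>H \<subseteq> {e. e \<subseteq> W \<and> card e = 2}; diameter_graph TYPE('d) W H\<rbrakk> \<Longrightarrow>
    (1 - \<delta>) / m * (real (card W))\<^sup>2 / 2 - card W - C \<le> card {e. e \<subseteq> W \<and> card e = 2 \<and> e \<notin> H}"
    using non_edges_diameter_graph[OF \<delta> d] unfolding m_def by blast
  obtain k0 where k0: "\<And>k. k \<ge> k0 \<Longrightarrow> - A * real k ^ 2 + (L - ln p) * real k + L * C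
      + (d' * real k + 1) * ln (2 * real k ^ 2 + 1) < - 1"
    using eventually_union_bound_small[OF A] unfolding eventually_sequentially by blast
  show ?thesis
  proof (intro exI[of _ k0] allI impI)
    fix k n :: nat and conn
    assume k: "k0 \<le> k" and n: "0 < n"
      and large: "(2 + \<epsilon>) * real (CARD('d) div 2) * log (1 / (1 - p)) (real n * p) < real k"
    define s where "s = (1 - \<delta>) / m * (real k)\<^sup>2 / 2 - k - C"
    have np: "ln (real n * p) = ln n + ln p" using n p by (simp add: ln_mult)
    have "log (1 / (1 - p)) (real n * p) = (ln n + ln p) / L"
      unfolding log_def np using p by (simp add: L_def ln_div)
    with large have "(2 + \<epsilon>) * m * ((ln n + ln p) / L) < k" by (simp add: m_def)
    then have "(2 + \<epsilon>) * m * (ln n + ln p) < L * k"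
      using L by (simp add: pos_divide_less_eq mult.commute)
    moreover have "0 < (2 + \<epsilon>) * m" using m eps by simp
    ultimately have "ln n + ln p < L * k / ((2 + \<epsilon>) * m)"
      by (subst pos_less_divide_eq) (simp_all only: mult.commute)
    then have ln_n: "ln n \<le> L * k / ((2 + \<epsilon>) * m) - ln p" by simp
    define X where "X = real n ^ k * (2 * real k ^ 2 + 1) ^ (CARD('d) * k + 1) * (1 - p) powr s"
    have pos: "0 < 2 * real k ^ 2 + 1" by (simp add: add_nonneg_pos)
    have X0: "0 < X" unfolding X_def using n p pos by simp
    have "ln X = k * ln n + (d' * k + 1) * ln (2 * real k ^ 2 + 1) - L * s"
    proof -
      have "ln (x ^ k * q ^ N * y powr s) = k * ln x + N * ln q + s * ln y"
        if "0 < x" "0 < q" "0 < y" for x q y :: real and N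
        using that by (simp add: ln_mult ln_realpow ln_powr)
      from this[of "real n" "2 * real k ^ 2 + 1" "1 - p" "CARD('d) * k + 1"]
      show ?thesis unfolding X_def using n p pos by (simp add: L_def d'_def)
    qed
    also have "\<dots> \<le> k * (L * k / ((2 + \<epsilon>) * m) - ln p) + (d' * k + 1) * ln (2 * real k ^ 2 + 1) - L * s"
      using ln_n by (intro diff_right_mono add_right_mono mult_left_mono) auto
    also have "\<dots> = - A * real k ^ 2 + (L - ln p) * real k + L * C
        + (d' * real k + 1) * ln (2 * real k ^ 2 + 1)"
      by (simp add: A_def s_def algebra_simps power2_eq_square)
    also have "\<dots> < - 1" by (rule k0[OF k])
    finally have "X < exp (- 1)" using X0 by (metis exp_less_cancel_iff exp_ln)
    moreover have "exp (- 1 :: real) \<le> 1 / 2"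
      using exp_ge_add_one_self[of "1 :: real"] by (simp add: exp_minus field_simps)
    moreover have "Pnp n p (good_event TYPE('d) conn n k) \<le> X"
      unfolding X_def using C by (intro Pnp_good_event_le[OF p]) (auto simp: s_def)
    ultimately show "Pnp n p (good_event TYPE('d) conn n k) \<le> 1 / 2" by linarith
  qed
qed

text \<open>The second assumption bounds the candidates, so their set is finite and
  \<open>Max\<close> is one of them; \<open>0 \<le> b\<close> covers the default value 0.\<close>

lemma u_gen_le:
  assumes "0 \<le> b" and "\<And>k. b < real k \<Longrightarrow> Pnp n p (good_event t conn n k) \<le> 1 / 2"
  shows "real (u_gen t conn n p) \<le> b"
proof -
  define S where "S = {k. 0 < k \<and> Pnp n p (good_event t conn n k) > 1/2}"
  have S: "real k \<le> b" if "k \<in> S" for k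
    using that assms(2)[of k] by (force simp: S_def)
  have "S \<subseteq> {..nat \<lfloor>b\<rfloor>}" using S by (auto simp: le_nat_floor)
  then have "finite S" using finite_subset by blast
  then have "real (if S = {} then 0 else Max S) \<le> b"
    using S Max_in[of S] assms(1) by auto
  then show ?thesis unfolding u_gen_def Let_def S_def .
qed

theorem theorem27:
  fixes p :: real and \<epsilon> :: real
  assumes "0 < p" "p < 1" "CARD('d::finite) \<ge> 2" "\<epsilon> > 0"
  shows "\<exists>n0. \<forall>n\<ge>n0.
     real (u_d TYPE('d) n p) \<le> (2 + \<epsilon>) * real (CARD('d) div 2) * log (1 / (1 - p)) (real n * p) \<and>
     real (u_d' TYPE('d) n p) \<le> (2 + \<epsilon>) * real (CARD('d) div 2) * log (1 / (1 - p)) (real n * p)"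
proof -
  define b where "b n = (2 + \<epsilon>) * real (CARD('d) div 2) * log (1 / (1 - p)) (real n * p)" for n
  obtain k0 where k0: "\<And>k n conn. \<lbrakk>k \<ge> k0; 0 < n; b n < real k\<rbrakk> \<Longrightarrow>
      Pnp n p (good_event TYPE('d) conn n k) \<le> 1 / 2"
    using good_event_unlikely[OF assms] unfolding b_def by blast
  have b: "b n = (2 + \<epsilon>) * real (CARD('d) div 2) / (- ln (1 - p)) * ln (real n * p)" for n
    using assms by (simp add: b_def log_def ln_div)
  have c: "0 < (2 + \<epsilon>) * real (CARD('d) div 2) / (- ln (1 - p))"
    using assms by (intro divide_pos_pos mult_pos_pos) auto
  have "filterlim (\<lambda>n. K * ln (real n * p)) at_top sequentially" if "0 < K" for K
    using that assms(1) by real_asymp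
  from this[OF c] have "filterlim b at_top sequentially" unfolding b .
  \<comment> \<open>Once \<open>b n\<close> has passed \<open>k0\<close>, every \<open>k\<close>
    above \<open>b n\<close> is large enough for the uniform estimate, and \<open>b n\<close> is
    nonnegative.\<close>
  then have "\<forall>\<^sub>F n in sequentially. real k0 \<le> b n"
    by (simp add: filterlim_at_top)
  then obtain n0 where n0: "\<And>n. n \<ge> n0 \<Longrightarrow> real k0 \<le> b n"
    unfolding eventually_sequentially by blast
  have "real (u_gen TYPE('d) conn n p) \<le> b n" if "n \<ge> max n0 1" for n conn
    using that n0[of n] by (intro u_gen_le k0) auto
  then show ?thesis unfolding u_d_def u_d'_def b_def by blast
qed

end
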